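(* Let $k\ge2$ and let $a_1,\ldots,a_k$ be positive integers. The generating function $\sum_\lambda q^{\lambda_1+\cdots+\lambda_k}$ of the integer sequences $(\lambda_1,\ldots,\lambda_k)$ satisfying \[\lambda_i\ge \frac{a_i}{a_{i+1}}\lambda_{i+1}\ (1\le i\le k-1),\qquad \lambda_k\ge0\] equals \[\frac{\displaystyle\sum_{z_2=0}^{a_2-1}\sum_{z_3=0}^{a_3-1}\cdots\sum_{z_k=0}^{a_k-1} q^{\lceil a_1z_2/a_2\rceil+\sum_{i=2}^k z_i}\prod_{i=2}^{k-1}q^{\,b_i\lceil z_{i+1}/a_{i+1}-z_i/a_i\rceil}}{\prod_{i=1}^k(1-q^{b_i})},\] where $b_1=1$ and $b_i=a_1+a_2+\cdots+a_i$ for $2\le i\le k$. *)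

theory Defs
  imports
    "HOL-Analysis.Analysis"
    "HOL-Library.FuncSet"
    "HOL-Computational_Algebra.Formal_Power_Series"
begin

(* Sequences (l_1, ..., l_k) are extensional functions on {1..k}, so that each sequence is
   represented exactly once. *)
definition ratio_seqs :: "nat \<Rightarrow> (nat \<Rightarrow> nat) \<Rightarrow> (nat \<Rightarrow> int) set" where
  "ratio_seqs k a = {l \<in> {1..k} \<rightarrow>\<^sub>E (UNIV :: int set).
     (\<forall>i\<in>{1..k-1}. real_of_int (l i) \<ge> real (a i) / real (a (i+1)) * real_of_int (l (i+1))) \<and>
     l k \<ge> 0}"

definition bseq :: "(nat \<Rightarrow> nat) \<Rightarrow> nat \<Rightarrow> nat" where
  "bseq a i = (if i = 1 then 1 else (\<Sum>j=1..i. a j))"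

(* The iterated sum over z_2, ..., z_k is a sum over the product of the ranges. The conversions
   nat below lose nothing, see residue_ceiling_nonneg. *)
definition numerator :: "nat \<Rightarrow> (nat \<Rightarrow> nat) \<Rightarrow> rat fps" where
  "numerator k a = (\<Sum>z \<in> (\<Pi>\<^sub>E i\<in>{2..k}. {0..<a i}).
     fps_X ^ (nat \<lceil>real (a 1) * real (z 2) / real (a 2)\<rceil> + (\<Sum>i=2..k. z i)) *
     (\<Prod>i=2..k-1. fps_X ^ (bseq a i *
        nat \<lceil>real (z (i+1)) / real (a (i+1)) - real (z i) / real (a i)\<rceil>)))"

definition denominator :: "nat \<Rightarrow> (nat \<Rightarrow> nat) \<Rightarrow> rat fps" where
  "denominator k a = (\<Prod>i=1..k. 1 - fps_X ^ bseq a i)"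

lemma residue_ceiling_nonneg:
  fixes x y c d :: nat
  assumes "y < d"
  shows "\<lceil>real x / real c - real y / real d\<rceil> \<ge> 0"
proof -
  have "real y / real d < 1" using assms by (simp add: divide_simps)
  moreover have "real x / real c \<ge> 0" by simp
  ultimately have "- 1 < real x / real c - real y / real d" by linarith
  then show ?thesis by linarith
qed

(* Hence the weight l_1 + ... + l_k is nonnegative and may be used as a nat exponent. *)
lemma ratio_seqs_nonneg:
  assumes "l \<in> ratio_seqs k a" "i \<in> {1..k}"
  shows "l i \<ge> 0"
proof -
  have "i \<le> k" using assms(2) by simp
  then show ?thesis using assms(2)
  proof (induction i rule: inc_induct)
    case base
    then show ?case using assms(1) by (simp add: ratio_seqs_def)
  next
    case (step n)
    then have "l (Suc n) \<ge> 0" by simp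
    moreover have "real_of_int (l n) \<ge> real (a n) / real (a (n+1)) * real_of_int (l (n+1))"
      using assms(1) step by (auto simp: ratio_seqs_def)
    moreover have "real (a n) / real (a (n+1)) * real_of_int (l (n+1)) \<ge> 0"
      using \<open>l (Suc n) \<ge> 0\<close> by simp
    ultimately show ?case by linarith
  qed
qed

end

theory Submission
  imports Defs
begin

text \<open>Write \<open>\<lambda>\<^sub>i = a\<^sub>i y\<^sub>i + z\<^sub>i\<close> with \<open>0 \<le> z\<^sub>i < a\<^sub>i\<close> for \<open>i \<ge> 2\<close>. For fixed residues \<open>z\<close> the
  inequalities become \<open>y\<^sub>i \<ge> y\<^sub>i\<^sub>+\<^sub>1 + c\<^sub>i\<close> and \<open>\<lambda>\<^sub>1 \<ge> a\<^sub>1 y\<^sub>2 + c\<^sub>1\<close> with \<open>c\<close> the ceilings in the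
  numerator. The slacks \<open>s\<^sub>1, \<dots>, s\<^sub>k\<close> of these inequalities are arbitrary naturals, and since
  \<open>y\<^sub>i = \<Sum>\<^sub>j\<^sub>\<ge>\<^sub>i (s\<^sub>j + c\<^sub>j)\<close>, the weight of \<open>\<lambda>\<close> is a function of \<open>z\<close> plus \<open>\<Sum>\<^sub>j b\<^sub>j s\<^sub>j\<close>. So
  the generating function is the product of a finite sum over \<open>z\<close> and \<open>k\<close> geometric series.\<close>

section \<open>Weight generating functions\<close>

text \<open>\<open>card\<close> of an infinite set is 0, so the coefficients count what they should
  only together with \<open>finite_fibres\<close>.\<close>

definition weight_gf :: "'a set \<Rightarrow> ('a \<Rightarrow> nat) \<Rightarrow> 'b :: field fps" where
  "weight_gf A w = Abs_fps (\<lambda>n. of_nat (card {x\<in>A. w x = n}))"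

definition finite_fibres :: "'a set \<Rightarrow> ('a \<Rightarrow> nat) \<Rightarrow> bool" where
  "finite_fibres A w \<longleftrightarrow> (\<forall>n. finite {x\<in>A. w x = n})"

text \<open>Links counting to infinite sums: convergence of formal power series is coefficientwise,
  and with finite fibres only finitely many terms contribute to each coefficient.\<close>

lemma has_sum_weight_gf:
  assumes "finite_fibres A w"
  shows "((\<lambda>x. fps_X ^ w x) has_sum (weight_gf A w :: 'b :: field fps)) A"
proof (rule has_sum_fpsI)
  fix n
  have eq: "{x\<in>A. fps_nth (fps_X ^ w x :: 'b fps) n \<noteq> 0} = {x\<in>A. w x = n}"
    by auto
  show "finite {x\<in>A. fps_nth (fps_X ^ w x :: 'b fps) n \<noteq> 0}"
    unfolding eq using assms by (simp only: finite_fibres_def)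
  show "fps_nth (weight_gf A w) n =
      (\<Sum>x | x \<in> A \<and> fps_nth (fps_X ^ w x) n \<noteq> (0 :: 'b). fps_nth (fps_X ^ w x) n)"
    unfolding eq by (simp add: weight_gf_def)
qed

lemma fibre_bij_betw:
  assumes "bij_betw f A B"
  shows "bij_betw f {x\<in>A. v (f x) = n} {y\<in>B. v y = n}"
  using assms by (auto simp: bij_betw_def inj_on_def)

lemma weight_gf_bij_betw:
  assumes "bij_betw f A B"
  shows "weight_gf A (\<lambda>x. v (f x)) = weight_gf B v"
  unfolding weight_gf_def using bij_betw_same_card[OF fibre_bij_betw[OF assms, of v]] by simp

lemma finite_fibres_bij_betw:
  assumes "bij_betw f A B"
  shows "finite_fibres A (\<lambda>x. v (f x)) \<longleftrightarrow> finite_fibres B v"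
  using bij_betw_finite[OF fibre_bij_betw[OF assms, of v]] by (simp add: finite_fibres_def)

lemma weight_gf_finite:
  assumes "finite A"
  shows "(weight_gf A w :: 'b :: field fps) = (\<Sum>x\<in>A. fps_X ^ w x)"
proof (rule fps_ext)
  fix n
  have "fps_nth (\<Sum>x\<in>A. fps_X ^ w x) n = (\<Sum>x\<in>A. if w x = n then 1 else 0 :: 'b)"
    by (auto simp: fps_sum_nth intro!: sum.cong)
  also have "\<dots> = of_nat (card {x\<in>A. w x = n})"
    using assms by (simp add: sum.If_cases Int_def)
  finally show "fps_nth (weight_gf A w) n = fps_nth (\<Sum>x\<in>A. fps_X ^ w x :: 'b fps) n"
    by (simp add: weight_gf_def)
qed

lemma fibre_Times:
  fixes v :: "'a \<Rightarrow> nat" and w :: "'b \<Rightarrow> nat"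
  shows "{p \<in> A \<times> B. v (fst p) + w (snd p) = n} =
    (\<Union>i\<le>n. {x\<in>A. v x = i} \<times> {y\<in>B. w y = n - i})"
  by auto

lemma finite_fibres_Times:
  assumes "finite_fibres A v" "finite_fibres B w"
  shows "finite_fibres (A \<times> B) (\<lambda>p. v (fst p) + w (snd p))"
  using assms by (auto simp: finite_fibres_def fibre_Times)

text \<open>Splitting a fibre over \<open>n\<close> by the weight \<open>i\<close> of the first
  component gives the Cauchy product of the coefficients.\<close>

lemma weight_gf_Times:
  assumes "finite_fibres A v" "finite_fibres B w"
  shows "weight_gf (A \<times> B) (\<lambda>p. v (fst p) + w (snd p)) = weight_gf A v * weight_gf B w"
proof (rule fps_ext)
  fix n
  have "card {p \<in> A \<times> B. v (fst p) + w (snd p) = n} =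
      (\<Sum>i\<le>n. card ({x\<in>A. v x = i} \<times> {y\<in>B. w y = n - i}))"
    unfolding fibre_Times using assms
    by (intro card_UN_disjoint) (auto simp: finite_fibres_def)
  then show "fps_nth (weight_gf (A \<times> B) (\<lambda>p. v (fst p) + w (snd p))) n =
      fps_nth (weight_gf A v * weight_gf B w) n"
    by (simp add: weight_gf_def fps_mult_nth card_cartesian_product atLeast0AtMost)
qed

section \<open>Geometric series and their finite products\<close>

lemma finite_fibres_multiples:
  assumes "b > 0"
  shows "finite_fibres UNIV ((*) b)"
proof -
  have "{m. b * m = n} \<subseteq> {..n}" for n using assms by (auto intro: le_trans)
  then show ?thesis by (auto simp: finite_fibres_def intro: finite_subset)
qed

lemma weight_gf_multiples:
  assumes "b > 0"
  shows "(weight_gf UNIV ((*) b) :: 'b :: field fps) = inverse (1 - fps_X ^ b)"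
proof -
  have card: "card {m. b * m = n} = (if b dvd n then 1 else 0)" for n
  proof (cases "b dvd n")
    case True
    then have "{m. b * m = n} = {n div b}" using assms by auto
    then show ?thesis using True by simp
  next
    case False
    then have "{m. b * m = n} = {}" by auto
    then show ?thesis using False by simp
  qed
  \<comment> \<open>Coefficient \<open>n - b\<close> is subtracted from coefficient
    \<open>n\<close>. For \<open>n\<close> at least \<open>b\<close> they agree, since
    \<open>b\<close> divides both indices or neither; below \<open>b\<close> only
    \<open>n = 0\<close> leaves a nonzero value.\<close>
  have "(1 - fps_X ^ b) * (weight_gf UNIV ((*) b) :: 'b fps) = 1"
  proof (rule fps_ext)
    fix n
    show "fps_nth ((1 - fps_X ^ b) * (weight_gf UNIV ((*) b) :: 'b fps)) n = fps_nth 1 n"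
      using assms
      by (cases "n < b") (auto simp: weight_gf_def card left_diff_distrib fps_X_power_mult_nth
          dvd_minus_self dest: dvd_imp_le)
  qed
  then show ?thesis
    using assms by (intro fps_inverse_unique[symmetric]) (simp_all add: mult.commute)
qed

lemma fps_nth_0_prod: "fps_nth (prod f I) 0 = (\<Prod>i\<in>I. fps_nth (f i :: 'a :: comm_ring_1 fps) 0)"
  by (induction I rule: infinite_finite_induct) auto

text \<open>Induction on \<open>I\<close>, splitting off one coordinate. Both claims go through the
  induction together because \<open>weight_gf_Times\<close> needs the finiteness for the smaller
  index set.\<close>

lemma weight_gf_PiE:
  assumes "finite I" "\<And>i. i \<in> I \<Longrightarrow> b i > 0"
  shows "finite_fibres (I \<rightarrow>\<^sub>E UNIV) (\<lambda>s. \<Sum>i\<in>I. b i * s i) \<and>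
    (weight_gf (I \<rightarrow>\<^sub>E UNIV) (\<lambda>s. \<Sum>i\<in>I. b i * s i) :: 'b :: field fps) =
      inverse (\<Prod>i\<in>I. 1 - fps_X ^ b i)"
  using assms
proof (induction I rule: finite_induct)
  case empty
  then show ?case by (simp add: weight_gf_finite finite_fibres_def)
next
  case (insert j I)
  let ?w = "\<lambda>I s. \<Sum>i\<in>I. b i * s i"
  let ?f = "\<lambda>(m, s). s(j := m)"
  have "b j > 0" using insert by simp
  have inj: "inj_on ?f (UNIV \<times> (I \<rightarrow>\<^sub>E UNIV))"
    using inj_combinator[of j I "\<lambda>_. UNIV"] insert by simp
  have bij: "bij_betw ?f (UNIV \<times> (I \<rightarrow>\<^sub>E UNIV)) (insert j I \<rightarrow>\<^sub>E UNIV)"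
    using inj by (simp add: bij_betw_def PiE_insert_eq)
  have wt: "?w (insert j I) (?f p) = b j * fst p + ?w I (snd p)" for p :: "nat \<times> ('a \<Rightarrow> nat)"
  proof -
    have "(\<Sum>i\<in>I. b i * (if i = j then fst p else snd p i)) = ?w I (snd p)"
      using insert by (intro sum.cong) auto
    then show ?thesis using insert by (simp add: case_prod_beta)
  qed
  have IH: "finite_fibres (I \<rightarrow>\<^sub>E UNIV) (?w I)"
    "(weight_gf (I \<rightarrow>\<^sub>E UNIV) (?w I) :: 'b fps) = inverse (\<Prod>i\<in>I. 1 - fps_X ^ b i)"
    using insert by auto
  note ff = finite_fibres_multiples[OF \<open>b j > 0\<close>]
  have "finite_fibres (insert j I \<rightarrow>\<^sub>E UNIV) (?w (insert j I))"
    using finite_fibres_bij_betw[OF bij, of "?w (insert j I)"] finite_fibres_Times[OF ff IH(1)]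
    unfolding wt by blast
  moreover have "(weight_gf (insert j I \<rightarrow>\<^sub>E UNIV) (?w (insert j I)) :: 'b fps) =
      inverse (\<Prod>i\<in>insert j I. 1 - fps_X ^ b i)"
  proof -
    have "(weight_gf (insert j I \<rightarrow>\<^sub>E UNIV) (?w (insert j I)) :: 'b fps) =
        weight_gf UNIV ((*) (b j)) * weight_gf (I \<rightarrow>\<^sub>E UNIV) (?w I)"
      by (rule trans[OF weight_gf_bij_betw[OF bij, of "?w (insert j I)", unfolded wt, symmetric]
            weight_gf_Times[OF ff IH(1)]])
    then show ?thesis
      using insert by (simp add: IH(2) weight_gf_multiples[OF \<open>b j > 0\<close>] fps_inverse_mult)
  qed
  ultimately show ?case by blast
qed

section \<open>The parametrisation of the sequences\<close>

text \<open>After division by \<open>a\<close> the two sides are integers plus fractions. As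
  \<open>y - y'\<close> is an integer, the difference of the fractions may be rounded up;
  \<open>z < a\<close> makes the ceiling nonnegative, so \<open>nat\<close> is harmless.\<close>

lemma ceiling_step_iff:
  fixes a d y z y' z' :: nat
  assumes "a > 0" "d > 0" "z < a"
  shows "real a / real d * real (d * y' + z') \<le> real (a * y + z) \<longleftrightarrow>
    y' + nat \<lceil>real z' / real d - real z / real a\<rceil> \<le> y"
proof -
  have "real a / real d * real (d * y' + z') = real a * (real y' + real z' / real d)"
    using assms by (simp add: field_simps)
  moreover have "real (a * y + z) = real a * (real y + real z / real a)"
    using assms by (simp add: field_simps)
  ultimately have "real a / real d * real (d * y' + z') \<le> real (a * y + z) \<longleftrightarrow>
      real y' + real z' / real d \<le> real y + real z / real a"
    using assms by (simp only: mult_le_cancel_left_pos of_nat_0_less_iff)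
  also have "\<dots> \<longleftrightarrow> real z' / real d - real z / real a \<le> of_int (int y - int y')"
    by (simp add: algebra_simps)
  also have "\<dots> \<longleftrightarrow> \<lceil>real z' / real d - real z / real a\<rceil> \<le> int y - int y'"
    by (simp add: ceiling_le_iff)
  also have "\<dots> \<longleftrightarrow> y' + nat \<lceil>real z' / real d - real z / real a\<rceil> \<le> y"
    using residue_ceiling_nonneg[OF assms(3), of z' d] by linarith
  finally show ?thesis .
qed

text \<open>The first entry \<open>x\<close> is not split into quotient and residue, so
  \<open>a * y\<close> is the integer part here and only \<open>a * z / d\<close> is rounded
  up.\<close>

lemma ceiling_first_iff:
  fixes a d x y z :: nat
  assumes "d > 0"
  shows "real a / real d * real (d * y + z) \<le> real x \<longleftrightarrow>
    a * y + nat \<lceil>real a * real z / real d\<rceil> \<le> x"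
proof -
  have "real a / real d * real (d * y + z) = real (a * y) + real a * real z / real d"
    using assms by (simp add: field_simps)
  then have "real a / real d * real (d * y + z) \<le> real x \<longleftrightarrow>
      real a * real z / real d \<le> of_int (int x - int (a * y))"
    by (simp add: algebra_simps)
  also have "\<dots> \<longleftrightarrow> \<lceil>real a * real z / real d\<rceil> \<le> int x - int (a * y)"
    by (simp only: ceiling_le_iff)
  also have "\<dots> \<longleftrightarrow> a * y + nat \<lceil>real a * real z / real d\<rceil> \<le> x"
  proof -
    have "\<lceil>real a * real z / real d\<rceil> \<ge> 0" by (simp add: order_less_le_trans[of "-1" 0])
    then show ?thesis by linarith
  qed
  finally show ?thesis .
qed

text \<open>The ceilings \<open>c\<^sub>i\<close> of the numerator, with \<open>c\<^sub>k = 0\<close> so that the condition \<open>\<lambda>\<^sub>k \<ge> 0\<close>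
  fits the pattern \<open>y\<^sub>k \<ge> y\<^sub>k\<^sub>+\<^sub>1 + c\<^sub>k\<close> with \<open>y\<^sub>k\<^sub>+\<^sub>1 = 0\<close>.\<close>

definition gap :: "nat \<Rightarrow> (nat \<Rightarrow> nat) \<Rightarrow> (nat \<Rightarrow> nat) \<Rightarrow> nat \<Rightarrow> nat" where
  "gap k a z i =
    (if i = 1 then nat \<lceil>real (a 1) * real (z 2) / real (a 2)\<rceil>
     else if i < k then nat \<lceil>real (z (i+1)) / real (a (i+1)) - real (z i) / real (a i)\<rceil>
     else 0)"

text \<open>For \<open>i\<close> at least 2 this is the quotient \<open>y_i\<close> expressed
  through the slacks: the recursion \<open>y_i = s_i + c_i + y_{i+1}\<close> unrolled down to
  \<open>y_{k+1} = 0\<close>.\<close>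

definition level :: "nat \<Rightarrow> (nat \<Rightarrow> nat) \<Rightarrow> (nat \<Rightarrow> nat) \<Rightarrow> (nat \<Rightarrow> nat) \<Rightarrow> nat \<Rightarrow> nat" where
  "level k a z s i = (\<Sum>j=i..k. s j + gap k a z j)"

text \<open>The first slack is added in units of 1 rather than \<open>a 1\<close>, which is why
  \<open>b_1 = 1\<close>.\<close>

definition assemble :: "nat \<Rightarrow> (nat \<Rightarrow> nat) \<Rightarrow> (nat \<Rightarrow> nat) \<times> (nat \<Rightarrow> nat) \<Rightarrow> nat \<Rightarrow> int" where
  "assemble k a = (\<lambda>(z, s). \<lambda>i\<in>{1..k}.
    int (if i = 1 then a 1 * level k a z s 2 + gap k a z 1 + s 1
         else a i * level k a z s i + z i))"

definition residues :: "nat \<Rightarrow> (nat \<Rightarrow> nat) \<Rightarrow> (nat \<Rightarrow> int) \<Rightarrow> nat \<Rightarrow> nat" where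
  "residues k a l = (\<lambda>i\<in>{2..k}. nat (l i) mod a i)"

text \<open>The value 0 beyond \<open>k\<close> supplies the boundary value
  \<open>y_{k+1} = 0\<close>.\<close>

definition quot :: "nat \<Rightarrow> (nat \<Rightarrow> nat) \<Rightarrow> (nat \<Rightarrow> int) \<Rightarrow> nat \<Rightarrow> nat" where
  "quot k a l i = (if i \<le> k then nat (l i) div a i else 0)"

text \<open>The subtractions are truncated, but on \<open>ratio_seqs\<close> the inequalities make
  them exact.\<close>

definition slacks :: "nat \<Rightarrow> (nat \<Rightarrow> nat) \<Rightarrow> (nat \<Rightarrow> int) \<Rightarrow> nat \<Rightarrow> nat" where
  "slacks k a l = (\<lambda>i\<in>{1..k}.
    if i = 1 then nat (l 1) - (a 1 * quot k a l 2 + gap k a (residues k a l) 1)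
    else quot k a l i - (quot k a l (i+1) + gap k a (residues k a l) i))"

lemma level_Suc: "i \<le> k \<Longrightarrow> level k a z s i = s i + gap k a z i + level k a z s (i+1)"
  by (simp add: level_def sum.atLeast_Suc_atMost)

lemma level_beyond: "k < i \<Longrightarrow> level k a z s i = 0"
  by (simp add: level_def)

locale ratio_parameters =
  fixes k :: nat and a :: "nat \<Rightarrow> nat"
  assumes k: "k \<ge> 2" and a_pos: "\<And>i. i \<in> {1..k} \<Longrightarrow> a i > 0"
begin

abbreviation "Z \<equiv> \<Pi>\<^sub>E i\<in>{2..k}. {0..<a i}"
abbreviation "S \<equiv> {1..k} \<rightarrow>\<^sub>E (UNIV :: nat set)"

text \<open>The two ceiling lemmas turn the real inequalities into inequalities between naturals.
  The condition at \<open>k\<close> disappears because \<open>l k\<close> is given as a natural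
  number.\<close>

lemma mem_ratio_seqs_iff:
  fixes x :: nat and y z :: "nat \<Rightarrow> nat" and l :: "nat \<Rightarrow> int"
  assumes l1: "l 1 = int x" and l: "\<And>i. i \<in> {2..k} \<Longrightarrow> l i = int (a i * y i + z i)"
    and z: "\<And>i. i \<in> {2..k} \<Longrightarrow> z i < a i"
    and ext: "l \<in> {1..k} \<rightarrow>\<^sub>E UNIV"
  shows "l \<in> ratio_seqs k a \<longleftrightarrow> a 1 * y 2 + gap k a z 1 \<le> x \<and>
    (\<forall>i\<in>{2..k-1}. y (i+1) + gap k a z i \<le> y i)"
proof -
  have "{1..k-1} = insert 1 {2..k-1}" using k by auto
  moreover have "l k \<ge> 0" using l[of k] k by simp
  moreover have "real (a 1) / real (a 2) * real_of_int (l 2) \<le> real_of_int (l 1) \<longleftrightarrow>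
      a 1 * y 2 + gap k a z 1 \<le> x"
    using ceiling_first_iff[of "a 2" "a 1" "y 2" "z 2" x] a_pos[of 2] k l[of 2] l1
    by (simp add: gap_def)
  moreover have "real (a i) / real (a (i+1)) * real_of_int (l (i+1)) \<le> real_of_int (l i) \<longleftrightarrow>
      y (i+1) + gap k a z i \<le> y i" if "i \<in> {2..k-1}" for i
  proof -
    have "l i = int (a i * y i + z i)" "l (i+1) = int (a (i+1) * y (i+1) + z (i+1))"
      and "gap k a z i = nat \<lceil>real (z (i+1)) / real (a (i+1)) - real (z i) / real (a i)\<rceil>"
      using that by (auto simp: l gap_def)
    moreover have "a i > 0" "a (i+1) > 0" "z i < a i" using that a_pos z by auto
    ultimately show ?thesis by (simp only: of_int_of_nat_eq ceiling_step_iff)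
  qed
  ultimately show ?thesis using ext by (simp add: ratio_seqs_def numeral_2_eq_2)
qed

section \<open>The bijection between pairs \<open>(z, s)\<close> and sequences\<close>

lemma assemble_1: "assemble k a (z, s) 1 = int (a 1 * level k a z s 2 + gap k a z 1 + s 1)"
  using k by (simp add: assemble_def)

lemma assemble_ge_2:
  "i \<in> {2..k} \<Longrightarrow> assemble k a (z, s) i = int (a i * level k a z s i + z i)"
  by (simp add: assemble_def)

lemma assemble_mem:
  assumes "z \<in> Z"
  shows "assemble k a (z, s) \<in> ratio_seqs k a"
proof -
  have "z i < a i" if "i \<in> {2..k}" for i
    using assms that by (auto simp: PiE_iff)
  moreover have "assemble k a (z, s) \<in> {1..k} \<rightarrow>\<^sub>E UNIV"
    by (simp add: assemble_def)
  moreover have "level k a z s (i+1) + gap k a z i \<le> level k a z s i" if "i \<in> {2..k-1}" for i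
    using that by (auto simp: level_Suc)
  ultimately show ?thesis
    using mem_ratio_seqs_iff[where l = "assemble k a (z, s)" and y = "level k a z s" and z = z,
        OF assemble_1 assemble_ge_2]
    by simp
qed

lemma residues_assemble:
  assumes "z \<in> Z"
  shows "residues k a (assemble k a (z, s)) = z"
proof
  fix i
  show "residues k a (assemble k a (z, s)) i = z i"
  proof (cases "i \<in> {2..k}")
    case True
    then have "z i < a i" using assms by auto
    then show ?thesis using True by (simp add: residues_def assemble_ge_2 del: of_nat_add of_nat_mult)
  next
    case False
    then show ?thesis using assms by (auto simp: residues_def)
  qed
qed

lemma quot_assemble:
  assumes "z \<in> Z" "i \<ge> 2"
  shows "quot k a (assemble k a (z, s)) i = level k a z s i"
proof (cases "i \<le> k")
  case True
  then have "z i < a i" using assms by (auto simp: PiE_iff)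
  then show ?thesis using True assms
    by (simp add: quot_def assemble_ge_2 del: of_nat_add of_nat_mult)
next
  case False
  then show ?thesis by (simp add: quot_def level_beyond)
qed

lemma slacks_assemble:
  assumes "z \<in> Z" "s \<in> S"
  shows "slacks k a (assemble k a (z, s)) = s"
proof
  fix i
  consider "i = 1" | "i \<in> {2..k}" | "i \<notin> {1..k}" by fastforce
  then show "slacks k a (assemble k a (z, s)) i = s i"
  proof cases
    case 1
    then show ?thesis using k assms
      by (simp add: slacks_def residues_assemble quot_assemble assemble_1[unfolded One_nat_def]
          del: of_nat_add of_nat_mult)
  next
    case 2
    then show ?thesis using assms
      by (simp add: slacks_def residues_assemble quot_assemble level_Suc)
  next
    case 3
    then show ?thesis using assms by (auto simp: slacks_def)
  qed
qed

lemma
  assumes l: "l \<in> ratio_seqs k a"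
  shows residues_mem: "residues k a l \<in> Z"
    and slacks_mem: "slacks k a l \<in> S"
    and assemble_residues_slacks: "assemble k a (residues k a l, slacks k a l) = l"
proof -
  let ?z = "residues k a l" and ?s = "slacks k a l" and ?y = "quot k a l"
  show Z: "?z \<in> Z" using a_pos by (auto simp: residues_def)
  show "?s \<in> S" by (auto simp: slacks_def)
  have ext: "l \<in> {1..k} \<rightarrow>\<^sub>E UNIV" using l by (simp add: ratio_seqs_def)
  have l1: "l 1 = int (nat (l 1))" using ratio_seqs_nonneg[OF l, of 1] k by simp
  have li: "l i = int (a i * ?y i + ?z i)" if "i \<in> {2..k}" for i
    using ratio_seqs_nonneg[OF l, of i] that
    by (simp add: quot_def residues_def flip: of_nat_mult of_nat_add)
  have ineq: "a 1 * ?y 2 + gap k a ?z 1 \<le> nat (l 1)"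
    "\<forall>i\<in>{2..k-1}. ?y (i+1) + gap k a ?z i \<le> ?y i"
    using mem_ratio_seqs_iff[OF l1 li _ ext] l Z by (auto simp: PiE_iff)
  \<comment> \<open>Extends the inequality to \<open>i = k\<close>, where both the gap and the next
    quotient are 0.\<close>
  have quot_step: "?y (i+1) + gap k a ?z i \<le> ?y i" if "i \<in> {2..k}" for i
    proof (cases "i = k")
    case True
    then show ?thesis using that by (simp add: quot_def gap_def)
  next
    case False
    then have "i \<in> {2..k-1}" using that by auto
    then show ?thesis using ineq(2) by blast
  qed
  \<comment> \<open>Downward induction from \<open>k + 1\<close>, where both sides are 0; by
    \<open>quot_step\<close> each slack restores exactly what was subtracted.\<close>
  have level: "level k a ?z ?s i = ?y i" if "i \<le> k + 1" "i \<ge> 2" for i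
    using that
  proof (induction i rule: inc_induct)
    case base
    then show ?case by (simp add: level_beyond quot_def)
  next
    case (step i)
    then have "?s i + gap k a ?z i + ?y (i+1) = ?y i"
      using quot_step[of i]
      by (simp add: slacks_def)
    then show ?case using step by (simp add: level_Suc)
  qed
  show "assemble k a (?z, ?s) = l"
  proof
    fix i
    consider "i = 1" | "i \<in> {2..k}" | "i \<notin> {1..k}" by fastforce
    then show "assemble k a (?z, ?s) i = l i"
    proof cases
      case 1
      have "a 1 * ?y 2 + gap k a ?z 1 + ?s 1 = nat (l 1)"
        using ineq(1) k by (simp add: slacks_def)
      then have "assemble k a (?z, ?s) 1 = int (nat (l 1))"
        using k by (simp only: assemble_1 level)
      then show ?thesis using 1 l1 by simp
    next
      case 2
      then show ?thesis by (simp only: assemble_ge_2 level li) (simp add: level)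
    next
      case 3
      then show ?thesis using ext by (auto simp: assemble_def)
    qed
  qed
qed

lemma bij_betw_assemble: "bij_betw (assemble k a) (Z \<times> S) (ratio_seqs k a)"
proof (rule bij_betw_byWitness[where f' = "\<lambda>l. (residues k a l, slacks k a l)"])
  show "\<forall>p\<in>Z \<times> S. (residues k a (assemble k a p), slacks k a (assemble k a p)) = p"
    using residues_assemble slacks_assemble by blast
  show "\<forall>l\<in>ratio_seqs k a. assemble k a (residues k a l, slacks k a l) = l"
    using assemble_residues_slacks by blast
  show "(\<lambda>l. (residues k a l, slacks k a l)) ` ratio_seqs k a \<subseteq> Z \<times> S"
    using residues_mem slacks_mem by blast
  show "assemble k a ` (Z \<times> S) \<subseteq> ratio_seqs k a"
    using assemble_mem by blast
qed

text \<open>The term at \<open>j\<close> enters \<open>level\<close> at every \<open>i\<close> from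
  2 to \<open>j\<close>, and at 2 once more with factor \<open>a 1\<close>. Its total coefficient is
  therefore \<open>a 1 + ... + a j = bseq a j\<close>.\<close>

lemma sum_mult_level:
  "a 1 * level k a z s 2 + (\<Sum>i=2..k. a i * level k a z s i) =
    (\<Sum>j=2..k. bseq a j * (s j + gap k a z j))"
proof -
  let ?t = "\<lambda>j. s j + gap k a z j"
  \<comment> \<open>The condition \<open>i \<le> j\<close> pads the triangular range to a square, so
    that the sums can be swapped.\<close>
  have "(\<Sum>i=2..k. a i * level k a z s i) = (\<Sum>i=2..k. \<Sum>j=2..k. if i \<le> j then a i * ?t j else 0)"
    unfolding level_def sum_distrib_left
    by (intro sum.cong sum.mono_neutral_cong_left) auto
  also have "\<dots> = (\<Sum>j=2..k. \<Sum>i=2..k. if i \<le> j then a i * ?t j else 0)"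
    by (rule sum.swap)
  also have "\<dots> = (\<Sum>j=2..k. (\<Sum>i=2..j. a i) * ?t j)"
    unfolding sum_distrib_right
    by (intro sum.cong sum.mono_neutral_cong_right) auto
  finally have eq: "(\<Sum>i=2..k. a i * level k a z s i) = (\<Sum>j=2..k. (\<Sum>i=2..j. a i) * ?t j)" .
  have "a 1 * level k a z s 2 = (\<Sum>j=2..k. a 1 * ?t j)"
    by (simp only: level_def sum_distrib_left)
  then have "a 1 * level k a z s 2 + (\<Sum>i=2..k. a i * level k a z s i) =
      (\<Sum>j=2..k. (a 1 + (\<Sum>i=2..j. a i)) * ?t j)"
    by (simp only: eq distrib_right sum.distrib)
  also have "\<dots> = (\<Sum>j=2..k. bseq a j * ?t j)"
  proof (intro sum.cong refl)
    fix j assume "j \<in> {2..k}"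
    then have "{1..j} = insert 1 {2..j}" "j \<noteq> 1" by auto
    then show "(a 1 + (\<Sum>i=2..j. a i)) * ?t j = bseq a j * ?t j"
      by (simp add: bseq_def)
  qed
  finally show ?thesis .
qed

text \<open>The weight of the sequence with residues \<open>z\<close> and all slacks 0, which is the
  exponent in the numerator.\<close>

definition residue_weight :: "(nat \<Rightarrow> nat) \<Rightarrow> nat" where
  "residue_weight z = gap k a z 1 + (\<Sum>i=2..k. z i) + (\<Sum>i=2..k-1. bseq a i * gap k a z i)"

lemma weight_assemble:
  "nat (\<Sum>i=1..k. assemble k a (z, s) i) = residue_weight z + (\<Sum>i=1..k. bseq a i * s i)"
proof -
  have range_eq: "{1..k} = insert 1 {2..k}" using k by auto
  have "(\<Sum>i=1..k. assemble k a (z, s) i) =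
      assemble k a (z, s) 1 + (\<Sum>i=2..k. assemble k a (z, s) i)"
    unfolding range_eq by simp
  also have "\<dots> = int (a 1 * level k a z s 2 + gap k a z 1 + s 1) +
      (\<Sum>i=2..k. int (a i * level k a z s i + z i))"
    by (simp only: assemble_1 assemble_ge_2 cong: sum.cong)
  also have "\<dots> = int (gap k a z 1 + s 1 + (\<Sum>i=2..k. z i) +
      (a 1 * level k a z s 2 + (\<Sum>i=2..k. a i * level k a z s i)))"
    by (simp add: sum.distrib)
  also have "\<dots> = int (gap k a z 1 + s 1 + (\<Sum>i=2..k. z i) +
      (\<Sum>j=2..k. bseq a j * (s j + gap k a z j)))"
    by (simp only: sum_mult_level)
  also have "(\<Sum>j=2..k. bseq a j * (s j + gap k a z j)) =
      (\<Sum>j=2..k. bseq a j * s j) + (\<Sum>j=2..k. bseq a j * gap k a z j)"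
    by (simp add: sum.distrib distrib_left)
  \<comment> \<open>The term at \<open>k\<close> drops out because the gap there is 0.\<close>
  also have "(\<Sum>j=2..k. bseq a j * gap k a z j) = (\<Sum>j=2..k-1. bseq a j * gap k a z j)"
    using k by (intro sum.mono_neutral_right) (auto simp: gap_def)
  also have "s 1 = bseq a 1 * s 1" by (simp add: bseq_def)
  finally show ?thesis by (simp only: residue_weight_def nat_int) (simp add: range_eq del: One_nat_def)
qed

lemma numerator_eq: "numerator k a = weight_gf Z residue_weight"
proof -
  have "finite Z" by (intro finite_PiE) auto
  moreover have "(\<Sum>i=2..k-1. bseq a i *
      nat \<lceil>real (z (i+1)) / real (a (i+1)) - real (z i) / real (a i)\<rceil>) =
      (\<Sum>i=2..k-1. bseq a i * gap k a z i)" for z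
    by (intro sum.cong) (auto simp: gap_def)
  ultimately show ?thesis
    unfolding numerator_def weight_gf_finite[OF \<open>finite Z\<close>]
    by (simp add: residue_weight_def gap_def power_add flip: power_sum)
qed

lemma has_sum_ratio_seqs:
  "((\<lambda>l. fps_X ^ nat (\<Sum>i=1..k. l i)) has_sum (numerator k a / denominator k a))
     (ratio_seqs k a)"
proof -
  let ?v = "\<lambda>s. \<Sum>i=1..k. bseq a i * s i"
  let ?w = "\<lambda>l. nat (\<Sum>i=1..k. l i)"
  have b_pos: "bseq a i > 0" if "i \<in> {1..k}" for i
    using that a_pos[of 1] member_le_sum[of 1 "{1..i}" a] by (auto simp: bseq_def)
  have Z: "finite_fibres Z residue_weight"
    by (auto simp: finite_fibres_def intro!: finite_subset[OF _ finite_PiE[of "{2..k}" "\<lambda>i. {0..<a i}"]])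
  have S: "finite_fibres S ?v" "(weight_gf S ?v :: rat fps) = inverse (denominator k a)"
    using weight_gf_PiE[of "{1..k}" "bseq a", where ?'b = rat] b_pos by (simp_all add: denominator_def)
  have wt: "?w (assemble k a p) = residue_weight (fst p) + ?v (snd p)" for p
    using weight_assemble[of "fst p" "snd p"] by simp
  have ff: "finite_fibres (ratio_seqs k a) ?w"
    using finite_fibres_bij_betw[OF bij_betw_assemble, of ?w] finite_fibres_Times[OF Z S(1)]
    unfolding wt by blast
  have "weight_gf (ratio_seqs k a) ?w = weight_gf Z residue_weight * (weight_gf S ?v :: rat fps)"
    by (rule trans[OF weight_gf_bij_betw[OF bij_betw_assemble, of ?w, unfolded wt, symmetric]
          weight_gf_Times[OF Z S(1)]])
  also have "\<dots> = numerator k a * inverse (denominator k a)"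
    by (simp only: S(2) numerator_eq)
  also have "\<dots> = numerator k a / denominator k a"
    \<comment> \<open>Every factor has constant term 1 because its exponent is positive, so the
      denominator is a unit.\<close>
    using b_pos by (subst fps_divide_unit) (auto simp: denominator_def fps_nth_0_prod)
  finally show ?thesis using has_sum_weight_gf[OF ff, where ?'b = rat] by simp
qed

end

theorem theorem2:
  fixes k :: nat and a :: "nat \<Rightarrow> nat"
  assumes "k \<ge> 2"
    and "\<And>i. i \<in> {1..k} \<Longrightarrow> a i > 0"
  shows "((\<lambda>l. fps_X ^ nat (\<Sum>i=1..k. l i)) has_sum (numerator k a / denominator k a))
           (ratio_seqs k a)"
proof -
  interpret ratio_parameters k a using assms by unfold_locales auto
  show ?thesis by (rule has_sum_ratio_seqs)
qed

end
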